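(* Let $\mathbb{K}$ be an algebraically closed field of characteristic zero, let $q(x)\in\mathbb{K}[x]$, and let $L=q(x)\mathbb{K}[x]\frac{\partial}{\partial x}\subseteq W_1(\mathbb{K})$. (1) If $\deg q(x)\ge 2$, then every nonzero finite-dimensional Lie subalgebra of $L$ is one-dimensional. (2) If $\deg q(x)=1$, then every nonzero finite-dimensional Lie subalgebra of $L$ is either one-dimensional or coincides with $$F_k=\left\langle q(x)\frac{\partial}{\partial x},\ q(x)^k\frac{\partial}{\partial x}\right\rangle$$ for some integer $k\ge 2$. (3) If $q(x)$ is a nonzero constant (i.e. $L=W_1(\mathbb{K})$), then every nonzero finite-dimensional Lie subalgebra of $L$ is either one-dimensional, or coincides with $$F_{k,\beta}=\left\langle (x+\beta)\frac{\partial}{\partial x},\ (x+\beta)^k\frac{\partial}{\partial x}\right\rangle$$ for some $\beta\in\mathbb{K}$ and some $k\in\{0,2,3,\ldots\}$, or is a three-dimensional subalgebra $$F(\beta)=\left\langle \frac{\partial}{\partial x},\ (x+\beta)\frac{\partial}{\partial x},\ (x+\beta)^2\frac{\partial}{\partial x}\right\rangle$$ for some $\beta\in\mathbb{K}$.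
   Context: $W_1(\mathbb{K})=\mathbb{K}[x]\frac{\partial}{\partial x}$ is the Lie algebra over $\mathbb{K}$ of all $\mathbb{K}$-linear derivations of $\mathbb{K}[x]$ with the commutator bracket, so $[f\frac{\partial}{\partial x},g\frac{\partial}{\partial x}]=(fg'-gf')\frac{\partial}{\partial x}$. The set $q(x)\mathbb{K}[x]\frac{\partial}{\partial x}$ consists of all derivations $q(x)p(x)\frac{\partial}{\partial x}$ with $p(x)\in\mathbb{K}[x]$ and is a Lie subalgebra of $W_1(\mathbb{K})$. Angle brackets denote the $\mathbb{K}$-linear span; dimensions are over $\mathbb{K}$. *)

theory Defs
  imports
    "HOL-Computational_Algebra.Computational_Algebra"
    "HOL-Library.Function_Algebras"
begin

definition der_scale :: "'a::field \<Rightarrow> ('a poly \<Rightarrow> 'a poly) \<Rightarrow> 'a poly \<Rightarrow> 'a poly"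
  where "der_scale c D = (\<lambda>p. smult c (D p))"

global_interpretation der: vector_space "der_scale :: 'a::field \<Rightarrow> _"
  by unfold_locales (simp_all add: der_scale_def fun_eq_iff smult_add_right smult_add_left)

definition fin_dim :: "('a::field poly \<Rightarrow> 'a poly) set \<Rightarrow> bool"
  where "fin_dim M \<longleftrightarrow> (\<exists>B. finite B \<and> der.span B = M)"

definition commutator ::
    "('a::field poly \<Rightarrow> 'a poly) \<Rightarrow> ('a poly \<Rightarrow> 'a poly) \<Rightarrow> 'a poly \<Rightarrow> 'a poly"
  where "commutator D E = (D \<circ> E) - (E \<circ> D)"

definition W1 :: "('a::field poly \<Rightarrow> 'a poly) set"
  where "W1 = {D. Vector_Spaces.linear smult smult D \<and> (\<forall>p r. D (p * r) = D p * r + p * D r)}"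

text \<open>\<open>derx f\<close> is the derivation $f(x)\frac{\partial}{\partial x}$.\<close>

definition derx :: "'a::field poly \<Rightarrow> 'a poly \<Rightarrow> 'a poly"
  where "derx f = (\<lambda>p. f * pderiv p)"

definition multW1 :: "'a::field poly \<Rightarrow> ('a poly \<Rightarrow> 'a poly) set"
  where "multW1 q = {derx (q * p) | p. True}"

definition lie_subalgebra ::
    "('a::field poly \<Rightarrow> 'a poly) set \<Rightarrow> ('a poly \<Rightarrow> 'a poly) set \<Rightarrow> bool"
  where "lie_subalgebra M L \<longleftrightarrow>
    M \<subseteq> L \<and> der.subspace M \<and> (\<forall>D\<in>M. \<forall>E\<in>M. commutator D E \<in> M)"

lemma vector_space_smult: "vector_space (smult :: 'a::field \<Rightarrow> _)"
  by unfold_locales (simp_all add: smult_add_right smult_add_left)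

lemma derx_in_W1: "derx f \<in> W1"
proof -
  have "Vector_Spaces.linear smult smult (derx f)"
    unfolding Vector_Spaces.linear_def module_hom_def module_hom_axioms_def
    using vector_space_smult
    by (auto simp: vector_space_def module_def derx_def pderiv_add pderiv_smult algebra_simps
        smult_add_right smult_add_left)
  then show ?thesis
    by (simp add: W1_def derx_def pderiv_mult algebra_simps)
qed

lemma W1_eq_range_derx: "(W1 :: ('a::field poly \<Rightarrow> 'a poly) set) = range derx"
proof
  show "range derx \<subseteq> (W1 :: ('a poly \<Rightarrow> 'a poly) set)"
    using derx_in_W1 by blast
  show "(W1 :: ('a poly \<Rightarrow> 'a poly) set) \<subseteq> range derx"
  proof
    fix D :: "'a poly \<Rightarrow> 'a poly"
    assume "D \<in> W1"
    then have lin: "Vector_Spaces.linear smult smult D"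
      and leib: "\<And>p r. D (p * r) = D p * r + p * D r"
      by (auto simp: W1_def)
    interpret Vector_Spaces.linear smult smult D by (rule lin)
    have "D 1 + D 1 = D 1 + 0"
      using leib[of 1 1] by (simp only: mult_1_left mult_1_right add_0_right)
    then have "D 1 = 0"
      by (rule add_left_imp_eq)
    then have const: "D [:a:] = 0" for a
      using scale[of a 1] by simp
    have "D p = D [:0, 1:] * pderiv p" for p
    proof (induction p)
      case 0
      show ?case by (simp add: zero)
    next
      case (pCons a p)
      have "pCons a p = [:a:] + [:0, 1:] * p" by simp
      then have "D (pCons a p) = D [:a:] + D ([:0, 1:] * p)" by (metis add)
      also have "\<dots> = D [:0, 1:] * p + [:0, 1:] * (D [:0, 1:] * pderiv p)"
        by (simp only: const leib pCons.IH) simp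
      also have "\<dots> = D [:0, 1:] * pderiv (pCons a p)"
        by (simp add: pderiv_pCons algebra_simps)
      finally show ?case .
    qed
    then have "D = derx (D [:0, 1:])"
      unfolding derx_def by (intro ext)
    then show "D \<in> range derx" by blast
  qed
qed

lemma commutator_derx: "commutator (derx f) (derx g) = derx (f * pderiv g - g * pderiv f)"
  by (simp add: commutator_def derx_def fun_eq_iff pderiv_mult algebra_simps)

lemma lie_subalgebra_multW1: "lie_subalgebra (multW1 q) W1"
proof -
  have "multW1 q \<subseteq> W1"
    using derx_in_W1 by (auto simp: multW1_def)
  moreover have "der.subspace (multW1 q)"
  proof (rule der.subspaceI)
    have "0 = derx (q * 0)"
      by (simp add: derx_def fun_eq_iff)
    then show "0 \<in> multW1 q"
      unfolding multW1_def by blast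
  next
    fix D E
    assume "D \<in> multW1 q" "E \<in> multW1 q"
    then obtain f g where "D = derx (q * f)" "E = derx (q * g)"
      by (auto simp: multW1_def)
    then have "D + E = derx (q * (f + g))"
      by (simp add: derx_def fun_eq_iff algebra_simps)
    then show "D + E \<in> multW1 q"
      unfolding multW1_def by blast
  next
    fix c D
    assume "D \<in> multW1 q"
    then obtain f where "D = derx (q * f)"
      by (auto simp: multW1_def)
    then have "der_scale c D = derx (q * smult c f)"
      by (simp add: derx_def der_scale_def fun_eq_iff)
    then show "der_scale c D \<in> multW1 q"
      unfolding multW1_def by blast
  qed
  moreover have "commutator D E \<in> multW1 q" if "D \<in> multW1 q" "E \<in> multW1 q" for D E
  proof -
    from that obtain f g where "D = derx (q * f)" "E = derx (q * g)"
      by (auto simp: multW1_def)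
    then have "commutator D E = derx (q * (f * pderiv (q * g) - g * pderiv (q * f)))"
      by (simp only: commutator_derx right_diff_distrib mult.assoc)
    then show ?thesis
      unfolding multW1_def by blast
  qed
  ultimately show ?thesis
    by (simp add: lie_subalgebra_def)
qed

lemma multW1_const:
  fixes q :: "'a::field poly"
  assumes "degree q = 0" "q \<noteq> 0"
  shows "multW1 q = W1"
proof -
  obtain c where c: "q = [:c:]" "c \<noteq> 0"
    using assms by (metis degree_eq_zeroE pCons_0_0)
  have "derx f \<in> multW1 q" for f
  proof -
    have "f = q * smult (inverse c) f"
      using c by simp
    then have "derx f = derx (q * smult (inverse c) f)" by (rule arg_cong)
    then show ?thesis
      unfolding multW1_def by blast
  qed
  then show ?thesis
    by (auto simp: W1_eq_range_derx multW1_def)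
qed

end

theory Submission
  imports Defs
begin

text \<open>
  The map \<open>derx\<close> identifies a subalgebra of $W_1$ with a space \<open>V\<close> of polynomials closed under
  the Wronskian bracket $fg' - gf'$. Everything comes from looking at the set of degrees of the
  nonzero elements of \<open>V\<close>. In characteristic zero, two polynomials of distinct degrees \<open>m\<close> and
  \<open>n\<close> have a bracket of degree exactly \<open>m + n - 1\<close>, because its top coefficient carries the
  factor \<open>n - m\<close> (\<open>wronskian_distinct_degrees\<close>). If \<open>V\<close> is finite-dimensional, its degrees have
  a maximum \<open>N\<close>; a smaller degree \<open>m\<close> then forces \<open>N + m - 1 \<le> N\<close>, that is \<open>m \<le> 1\<close>. So the
  possible degree sets are \<open>{N}\<close>, \<open>{0, 1}\<close>, \<open>{1, N}\<close> and \<open>{0, 1, 2}\<close>: degrees \<open>0\<close> and \<open>N \<ge> 2\<close>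
  together produce the degree \<open>N - 1\<close>, which must again be at most \<open>1\<close>.

  A space of polynomials is spanned by any of its elements that realise all of its degrees
  (\<open>span_eq_if_same_degrees\<close>), so the degree set \<open>{N}\<close> gives a line, \<open>{0, 1}\<close> and \<open>{0, 1, 2}\<close>
  give all polynomials of degree at most \<open>1\<close> or \<open>2\<close>. For \<open>{1, N}\<close> let \<open>l\<close> be the monic linear
  element and \<open>F\<close> an element of degree \<open>N\<close>. Bracketing with \<open>l\<close> is diagonalised by the powers of
  \<open>l\<close>, with \<open>l ^ N\<close> for the eigenvalue \<open>N - 1\<close>; modulo \<open>l\<close> the element \<open>F\<close> is an eigenvector for
  that eigenvalue, and hence \<open>F\<close> is a combination of \<open>l ^ N\<close> and \<open>l\<close>
  (\<open>wronskian_linear_eigen\<close>). This proves \<open>wronskian_closed_classification\<close>.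

  The polynomial \<open>q\<close> enters only at the end: it divides all elements of \<open>V\<close>. Thus
  \<open>degree q \<ge> 2\<close> leaves only the lines, while \<open>degree q = 1\<close> excludes constants and makes \<open>l\<close> a
  scalar multiple of \<open>q\<close>.
\<close>

section \<open>Degrees of Wronskian brackets\<close>

global_interpretation pol: vector_space "smult :: 'a::field \<Rightarrow> _"
  by (rule vector_space_smult)

text \<open>The coefficient of the commutator of $f \frac{\partial}{\partial x}$ and
  $g \frac{\partial}{\partial x}$.\<close>

definition wronskian :: "'a::field poly \<Rightarrow> 'a poly \<Rightarrow> 'a poly"
  where "wronskian f g = f * pderiv g - g * pderiv f"

lemma coeff_mult_pderiv_top:
  fixes f g :: "'a::{field, field_char_0} poly"
  assumes "degree f + degree g > 0"
  shows "coeff (f * pderiv g) (degree f + degree g - 1)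
    = of_nat (degree g) * lead_coeff f * lead_coeff g"
proof (cases "degree g = 0")
  case True
  then have "pderiv g = 0" by (simp add: pderiv_eq_0_iff)
  then show ?thesis using True by simp
next
  case False
  then have "degree f + degree g - 1 = degree f + degree (pderiv g)"
    by (simp add: degree_pderiv)
  then have "coeff (f * pderiv g) (degree f + degree g - 1) = lead_coeff f * lead_coeff (pderiv g)"
    by (simp add: coeff_mult_degree_sum)
  also have "lead_coeff (pderiv g) = of_nat (degree g) * lead_coeff g"
    using False by (simp add: degree_pderiv coeff_pderiv)
  finally show ?thesis by (simp add: mult_ac)
qed

lemma degree_mult_pderiv_le:
  fixes f g :: "'a::{field, field_char_0} poly"
  shows "degree (f * pderiv g) \<le> degree f + degree g - 1"
proof (cases "degree g = 0")
  case True
  then have "pderiv g = 0" by (simp add: pderiv_eq_0_iff)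
  then show ?thesis by simp
next
  case False
  have "degree (f * pderiv g) \<le> degree f + degree (pderiv g)" by (rule degree_mult_le)
  then show ?thesis using False by (simp add: degree_pderiv)
qed

lemma coeff_wronskian_top:
  fixes f g :: "'a::{field, field_char_0} poly"
  assumes "degree f + degree g > 0"
  shows "coeff (wronskian f g) (degree f + degree g - 1)
    = (of_nat (degree g) - of_nat (degree f)) * lead_coeff f * lead_coeff g"
  using coeff_mult_pderiv_top[of f g] coeff_mult_pderiv_top[of g f] assms
  by (simp add: wronskian_def add.commute algebra_simps)

lemma degree_wronskian_le:
  fixes f g :: "'a::{field, field_char_0} poly"
  shows "degree (wronskian f g) \<le> degree f + degree g - 1"
  unfolding wronskian_def
  using degree_mult_pderiv_le[of f g] degree_mult_pderiv_le[of g f]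
  by (intro degree_diff_le) (simp_all add: add.commute)

text \<open>The top coefficients of $fg'$ and $gf'$ can only cancel when the degrees agree, since the
  integer \<open>degree g - degree f\<close> stays nonzero in characteristic zero.\<close>

lemma wronskian_distinct_degrees:
  fixes f g :: "'a::{field, field_char_0} poly"
  assumes "f \<noteq> 0" "g \<noteq> 0" "degree f \<noteq> degree g"
  shows "wronskian f g \<noteq> 0" and "degree (wronskian f g) = degree f + degree g - 1"
proof -
  have "coeff (wronskian f g) (degree f + degree g - 1) \<noteq> 0"
    using assms by (subst coeff_wronskian_top) auto
  then show "wronskian f g \<noteq> 0" "degree (wronskian f g) = degree f + degree g - 1"
    using degree_wronskian_le[of f g] le_degree[of "wronskian f g"] by (auto intro: antisym)
qed

section \<open>Spaces of polynomials and their degrees\<close>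

lemma degree_cancel_lead:
  fixes f g :: "'a::field poly"
  assumes "g \<noteq> 0" "degree f = degree g" "f \<noteq> smult (lead_coeff f / lead_coeff g) g"
  shows "degree (f - smult (lead_coeff f / lead_coeff g) g) < degree f"
proof -
  let ?h = "f - smult (lead_coeff f / lead_coeff g) g"
  have "coeff ?h (degree f) = 0" using assms by simp
  moreover have "?h \<noteq> 0" using assms(3) by simp
  moreover have "degree ?h \<le> degree f"
    by (intro degree_diff_le) (use assms in auto)
  ultimately show ?thesis
    by (metis le_neq_implies_less leading_coeff_0_iff)
qed

text \<open>Gaussian elimination on leading terms: an element of \<open>B\<close> of the right degree cancels the
  leading term of \<open>f\<close>, and induction on the degree does the rest.\<close>

lemma span_eq_if_same_degrees:
  fixes V :: "'a::field poly set"
  assumes V: "pol.subspace V" and B: "B \<subseteq> V"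
    and deg: "\<And>f. f \<in> V \<Longrightarrow> f \<noteq> 0 \<Longrightarrow> \<exists>b\<in>B. b \<noteq> 0 \<and> degree b = degree f"
  shows "pol.span B = V"
proof
  show "pol.span B \<subseteq> V" using B V by (rule pol.span_minimal)
  have "f \<in> V \<Longrightarrow> f \<in> pol.span B" for f
  proof (induction "degree f" arbitrary: f rule: less_induct)
    case less
    show ?case
    proof (cases "f = 0")
      case True then show ?thesis by (simp add: pol.span_zero)
    next
      case False
      then obtain b where b: "b \<in> B" "b \<noteq> 0" "degree f = degree b"
        using deg less.prems by metis
      let ?s = "smult (lead_coeff f / lead_coeff b) b"
      have s: "?s \<in> pol.span B" using b by (intro pol.span_scale pol.span_base)
      show ?thesis
      proof (cases "f = ?s")
        case True then show ?thesis using s by simp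
      next
        case False
        have "f - ?s \<in> V"
          using V B b less.prems by (intro pol.subspace_diff pol.subspace_scale) auto
        then have "f - ?s \<in> pol.span B"
          using less.hyps degree_cancel_lead[OF b(2,3) False] by blast
        then show ?thesis using s pol.span_add[of "f - ?s" B ?s] by simp
      qed
    qed
  qed
  then show "V \<subseteq> pol.span B" by blast
qed

lemma subspace_degree_le: "pol.subspace {f :: 'a::field poly. degree f \<le> n}"
  by (intro pol.subspaceI) (auto intro: degree_add_le)

lemma degree_bounded_finite_span:
  fixes B :: "'a::field poly set"
  assumes "finite B"
  obtains n where "\<And>f. f \<in> pol.span B \<Longrightarrow> degree f \<le> n"
proof
  fix f assume "f \<in> pol.span B"
  moreover have "pol.span B \<subseteq> {f. degree f \<le> Max (degree ` B)}"
    using assms by (intro pol.span_minimal subspace_degree_le) auto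
  ultimately show "degree f \<le> Max (degree ` B)" by blast
qed

section \<open>Spaces closed under the Wronskian bracket\<close>

text \<open>With $l = x + \beta$, the bracket with \<open>l\<close> maps $l^i$ to $(i-1)\,l^i$. The hypothesis says that
  \<open>f\<close> is, up to a multiple of \<open>l\<close>, an eigenvector for $n - 1$. Subtracting suitable multiples
  of $l^n$ and \<open>l\<close> leaves a polynomial \<open>g\<close> with $l g' = n g$ and no term of degree \<open>n\<close>.
  Comparing leading coefficients in this equation makes \<open>n\<close> the only possible degree of a
  nonzero solution, so \<open>g = 0\<close>.\<close>

lemma wronskian_linear_eigen:
  fixes f :: "'a::{field, field_char_0} poly"
  assumes f: "f \<noteq> 0" "degree f = n" and n: "n \<ge> 2"
    and eigen: "wronskian [:\<beta>, 1:] f - smult (of_nat (n - 1)) f = smult c [:\<beta>, 1:]"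
  shows "f = smult (lead_coeff f) ([:\<beta>, 1:] ^ n) - smult (c / of_nat (n - 1)) [:\<beta>, 1:]"
proof (rule ccontr)
  define l where "l = [:\<beta>, 1:]"
  define T where "T = (\<lambda>h. l * pderiv h - smult (of_nat n) h)"
  define d where "d = c / of_nat (n - 1)"
  define a where "a = lead_coeff f"
  define g where "g = f - smult a (l ^ n) + smult d l"
  assume "\<not> ?thesis"
  then have g0: "g \<noteq> 0"
    by (auto simp: g_def a_def d_def l_def algebra_simps eq_neg_iff_add_eq_0)
  have l: "pderiv l = 1" "l \<noteq> 0" "degree l = 1"
    by (simp_all add: l_def pderiv_pCons one_pCons)
  have n1: "of_nat (n - 1) = (of_nat n - 1 :: 'a)" and n1': "(of_nat n - 1 :: 'a) \<noteq> 0"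
    using n by (simp_all add: of_nat_diff)
  have "smult (of_nat n) f = smult (of_nat (n - 1)) f + f"
    unfolding n1 by (simp add: smult_diff_left)
  then have Tf: "T f = smult c l"
    using eigen l(1) by (simp add: T_def wronskian_def l_def[symmetric] diff_diff_eq add.commute)
  have Tl: "T l = smult (1 - of_nat n) l"
    using l by (simp add: T_def smult_diff_left)
  have Tp: "T (l ^ n) = 0"
  proof -
    have "l * pderiv (l ^ n) = smult (of_nat n) (l ^ n)"
      using n l(1) pderiv_power_Suc[of l "n - 1"] power_Suc[of l "n - 1"] by simp
    then show ?thesis by (simp add: T_def)
  qed
  have "T g = T f - smult a (T (l ^ n)) + smult d (T l)"
    by (simp add: T_def g_def pderiv_add pderiv_diff pderiv_smult algebra_simps
        smult_add_right smult_diff_right)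
  also have "\<dots> = smult (c + d * (1 - of_nat n)) l"
    by (simp add: Tf Tl Tp smult_add_left)
  also have "c + d * (1 - of_nat n) = 0"
    using n1' unfolding d_def n1 by (simp add: field_simps)
  finally have Tg: "T g = 0" by simp
  have lc: "coeff (T g) (degree g) = (of_nat (degree g) - of_nat n) * lead_coeff g"
  proof -
    have "coeff (l * pderiv g) (degree g) = of_nat (degree g) * lead_coeff g"
      using coeff_mult_pderiv_top[of l g] l by (simp add: l_def)
    then show ?thesis by (simp add: T_def algebra_simps)
  qed
  have "degree (l ^ n) = n" using l by (simp add: degree_power_eq)
  moreover have "lead_coeff (l ^ n) = 1" by (simp add: lead_coeff_power l_def)
  ultimately have "coeff g n = 0"
    using f n l by (simp add: g_def a_def coeff_eq_0)
  with g0 have "degree g \<noteq> n" by auto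
  then have "(of_nat (degree g) :: 'a) - of_nat n \<noteq> 0" by simp
  with Tg lc g0 show False by simp
qed

text \<open>Bracketing with an element of the highest degree \<open>N\<close> must not raise the degree, so every
  smaller degree is at most \<open>1\<close>. If there is a smaller degree at all, a linear element exists: a
  constant forces \<open>N \<le> 2\<close>, and for \<open>N = 2\<close> its bracket with the top element is linear.\<close>

lemma wronskian_closed_classification [consumes 4]:
  fixes V :: "'a::{field, field_char_0} poly set"
  assumes V: "pol.subspace V" "V \<noteq> {0}"
    and wronskian_in: "\<forall>f\<in>V. \<forall>g\<in>V. wronskian f g \<in> V"
    and bounded: "\<forall>f\<in>V. degree f \<le> n"
  obtains (line) f where "f \<noteq> 0" "V = pol.span {f}"
  | (plane) \<beta> k where "k = 0 \<or> k \<ge> 2" "V = pol.span {[:\<beta>, 1:], [:\<beta>, 1:] ^ k}"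
  | (space) "V = pol.span {1, [:0, 1:], [:0, 1:] ^ 2}"
proof -
  from wronskian_in have closed: "wronskian f g \<in> V" if "f \<in> V" "g \<in> V" for f g
    using that by blast
  obtain F where F: "F \<in> V" "F \<noteq> 0" and top: "\<And>g. g \<in> V \<Longrightarrow> degree g \<le> degree F"
  proof -
    obtain f0 where f0: "f0 \<in> V \<and> f0 \<noteq> 0" using V pol.subspace_0 by blast
    show ?thesis
      using ex_has_greatest_nat[of "\<lambda>f. f \<in> V \<and> f \<noteq> 0" f0 degree "Suc n"] f0 bounded that
      by (metis degree_0 le0 le_imp_less_Suc)
  qed
  define N where "N = degree F"
  have low: "degree g \<le> 1" "\<exists>h\<in>V. h \<noteq> 0 \<and> degree h = N + degree g - 1"
    if g: "g \<in> V" "g \<noteq> 0" "degree g < N" for g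
  proof -
    have w: "wronskian F g \<in> V" "wronskian F g \<noteq> 0" "degree (wronskian F g) = N + degree g - 1"
      using closed[OF F(1) g(1)] wronskian_distinct_degrees[of F g] F g by (auto simp: N_def)
    then show "\<exists>h\<in>V. h \<noteq> 0 \<and> degree h = N + degree g - 1" by blast
    show "degree g \<le> 1" using top[OF w(1)] w(3) g(3) by (simp add: N_def)
  qed
  show ?thesis
  proof (cases "\<forall>g\<in>V. g \<noteq> 0 \<longrightarrow> degree g = N")
    case True
    then have "pol.span {F} = V"
      using F by (intro span_eq_if_same_degrees V(1)) (blast | metis N_def singletonI)+
    then show ?thesis using line[OF F(2)] by simp
  next
    case False
    then obtain g where g: "g \<in> V" "g \<noteq> 0" "degree g < N"
      using top by (auto simp: N_def le_less)
    (* A constant together with degree N \<ge> 2 yields the degree N - 1 < N, which is at most 1. *)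
    have const: "N \<le> 2" if "h \<in> V" "h \<noteq> 0" "degree h = 0" for h
    proof (cases "N \<le> 1")
      case False
      then have "degree h < N" using that(3) by simp
      with low(2)[OF that(1,2)] that(3) obtain h'
        where "h' \<in> V" "h' \<noteq> 0" "degree h' = N - 1" by (metis add_0_right)
      then show ?thesis using low(1)[of h'] False by simp
    qed simp
    have "\<exists>h\<in>V. h \<noteq> 0 \<and> degree h = 1"
    proof (cases "degree g = 1")
      case True then show ?thesis using g by blast
    next
      case False
      then have g0: "degree g = 0" using low(1)[OF g] by simp
      then have "N = 1 \<or> N = 2" using const[OF g(1,2)] g(3) by auto
      then show ?thesis using F low(2)[OF g] g0 by (auto simp: N_def)
    qed
    then obtain h where h: "h \<in> V" "degree h = 1" by blast
    then obtain a b where ab: "h = [:a, b:]" "b \<noteq> 0" by (metis degree1_coeffs)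
    define l where "l = [:a / b, 1:]"
    have "l = smult (inverse b) h" using ab by (simp add: l_def field_simps)
    then have lV: "l \<in> V" using pol.subspace_scale[OF V(1) h(1)] by simp
    have ldeg: "l \<noteq> 0" "degree l = 1" by (simp_all add: l_def)
    show ?thesis
    proof (cases "\<exists>h\<in>V. h \<noteq> 0 \<and> degree h = 0")
      case True
      then obtain h where h: "h \<in> V" "h \<noteq> 0" "degree h = 0" by blast
      then obtain e where e: "h = [:e:]" "e \<noteq> 0" by (metis degree_eq_zeroE pCons_0_0)
      then have "1 = smult (inverse e) h" by (simp add: one_pCons)
      then have oneV: "1 \<in> V" using pol.subspace_scale[OF V(1) h(1)] by metis
      have "N = 1 \<or> N = 2" using const[OF h] g(3) by auto
      then show ?thesis
      proof
        assume N: "N = 1"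
        have "pol.span {l, l ^ 0} = V"
        proof (rule span_eq_if_same_degrees[OF V(1)])
          fix f assume "f \<in> V" "f \<noteq> 0"
          then have "degree f = 1 \<or> degree f = 0" using top[of f] N by (auto simp: N_def)
          then show "\<exists>b\<in>{l, l ^ 0}. b \<noteq> 0 \<and> degree b = degree f" using ldeg by auto
        qed (use lV oneV in auto)
        then show ?thesis using plane[of 0 "a / b"] by (simp add: l_def)
      next
        assume N: "N = 2"
        let ?P = "{f :: 'a poly. degree f \<le> 2}"
        have *: "pol.span {1, u, v} = U"
          if "pol.subspace U" "U \<subseteq> ?P" "1 \<in> U" "u \<in> U" "v \<in> U" "degree u = 1" "degree v = 2"
          for u v and U :: "'a poly set"
        proof (rule span_eq_if_same_degrees[OF that(1)])
          fix f assume "f \<in> U" "f \<noteq> 0"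
          then have "degree f = 0 \<or> degree f = 1 \<or> degree f = 2" using that(2) by fastforce
          then show "\<exists>b\<in>{1, u, v}. b \<noteq> 0 \<and> degree b = degree f" using that by force
        qed (use that in auto)
        (* Both triples realise the degrees 0, 1, 2, so they span all quadratics, and so does V. *)
        have "pol.span {1, l, F} = V"
          using V lV oneV F top ldeg N by (intro *) (auto simp: N_def)
        moreover have "pol.span {1, l, F} = ?P"
          using ldeg N by (intro * subspace_degree_le) (auto simp: N_def)
        moreover have "pol.span {1, [:0, 1:], [:0, 1:] ^ 2} = ?P"
          by (intro * subspace_degree_le) (auto simp: degree_power_eq)
        ultimately show ?thesis using space by simp
      qed
    next
      case False
      then have N: "N \<ge> 2" using low(1)[OF g] g by force
      have degs: "degree f = 1 \<or> degree f = N" if "f \<in> V" "f \<noteq> 0" for f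
        using False that top[of f] low(1)[of f] by (force simp: N_def)
      (* The coefficient N - 1 kills the top term, so w has degree below N, hence is a multiple of l. *)
      define w where "w = wronskian l F - smult (of_nat (N - 1)) F"
      have wV: "w \<in> V"
        unfolding w_def using V closed lV F by (intro pol.subspace_diff pol.subspace_scale) auto
      have "coeff w N = 0"
        using coeff_wronskian_top[of l F] ldeg N
        by (simp add: w_def N_def l_def of_nat_diff)
      then have "w = 0 \<or> degree w \<noteq> N" using leading_coeff_0_iff[of w] by auto
      then have w1: "w = 0 \<or> degree w = 1" using degs wV by blast
      have "w = smult (lead_coeff w / lead_coeff l) l"
      proof (rule ccontr)
        let ?s = "smult (lead_coeff w / lead_coeff l) l"
        assume ne: "w \<noteq> ?s"
        then have "degree w = degree l" using w1 ldeg by auto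
        then have "degree (w - ?s) < 1" using degree_cancel_lead[OF ldeg(1) _ ne] ldeg by simp
        moreover have "w - ?s \<in> V" using V wV lV by (intro pol.subspace_diff pol.subspace_scale)
        ultimately show False using False ne by auto
      qed
      then obtain c where "w = smult c l" by blast
      then have "F = smult (lead_coeff F) (l ^ N) - smult (c / of_nat (N - 1)) l"
        using wronskian_linear_eigen[OF F(2) N_def[symmetric] N, of "a / b" c]
        by (simp add: w_def l_def)
      then have "l ^ N = smult (inverse (lead_coeff F)) (F + smult (c / of_nat (N - 1)) l)"
        using F(2) by (metis diff_add_cancel leading_coeff_0_iff left_inverse smult_1_left smult_smult)
      then have "l ^ N \<in> V"
        using V F lV by (metis pol.subspace_add pol.subspace_scale)
      moreover have "degree (l ^ N) = N" "l ^ N \<noteq> 0" using ldeg by (simp_all add: degree_power_eq)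
      ultimately have "pol.span {l, l ^ N} = V"
        using degs lV ldeg by (intro span_eq_if_same_degrees V) force+
      then show ?thesis using plane[of N "a / b"] N by (simp add: l_def)
    qed
  qed
qed

section \<open>Transfer to derivations\<close>

lemma linear_derx: "Vector_Spaces.linear smult der_scale (derx :: 'a::field poly \<Rightarrow> _)"
  by unfold_locales (simp_all add: derx_def der_scale_def fun_eq_iff algebra_simps)

lemma inj_derx: "inj (derx :: 'a::field poly \<Rightarrow> _)"
proof (rule injI)
  fix f g :: "'a poly" assume "derx f = derx g"
  then have "derx f [:0, 1:] = derx g [:0, 1:]" by simp
  then show "f = g" by (simp add: derx_def pderiv_pCons one_pCons[symmetric])
qed

lemma der_span_derx: "der.span (derx ` B) = derx ` pol.span B"
proof -
  interpret Vector_Spaces.linear smult der_scale derx by (rule linear_derx)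
  show ?thesis by (rule span_image)
qed

lemma der_dim_span_derx:
  assumes "pol.independent B"
  shows "der.dim (derx ` pol.span B) = card B"
proof -
  interpret Vector_Spaces.linear smult der_scale derx by (rule linear_derx)
  have "der.independent (derx ` B)"
    using assms inj_derx by (intro independent_injective_image) (auto intro: inj_on_subset)
  then show ?thesis
    using inj_derx by (metis card_image der.dim_span_eq_card_independent der_span_derx inj_on_subset subset_UNIV)
qed

lemma independent_powers_upto_2: "pol.independent {1, [:0, 1:], [:0, 1:] ^ 2 :: 'a::field poly}"
proof -
  let ?x = "[:0, 1:] :: 'a poly"
  have span_le: "pol.span B \<subseteq> {f. degree f \<le> n}" if "\<forall>b\<in>B. degree b \<le> n" for B :: "'a poly set" and n
    using that by (intro pol.span_minimal subspace_degree_le) auto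
  have "?x ^ 2 \<notin> pol.span {?x, 1}"
    using span_le[of "{?x, 1}" 1] by (auto simp: degree_power_eq)
  moreover have "?x \<notin> pol.span {1}"
    using span_le[of "{1}" 0] by auto
  ultimately have "pol.independent {?x ^ 2, ?x, 1}"
    by (simp add: pol.independent_insert)
  then show ?thesis by (simp add: insert_commute)
qed

lemma lie_subalgebra_elements_dvd:
  assumes "lie_subalgebra M (multW1 q)" and "derx f \<in> M"
  shows "q dvd f"
proof -
  from assms obtain p where "derx f = derx (q * p)"
    by (auto simp: lie_subalgebra_def multW1_def)
  then have "f = q * p" by (rule injD[OF inj_derx])
  then show ?thesis by simp
qed

text \<open>The members of \<open>M\<close> listed in the last two cases are those whose coefficients \<open>q\<close> must divide;
  the degree of \<open>q\<close> then decides which cases survive.\<close>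

lemma lie_subalgebra_classification [consumes 3]:
  fixes q :: "'a::{field, field_char_0} poly"
  assumes M: "lie_subalgebra M (multW1 q)" "fin_dim M" "M \<noteq> {0}"
  obtains (line) "der.dim M = 1"
  | (plane) \<beta> k where "k = 0 \<or> k \<ge> 2" "derx [:\<beta>, 1:] \<in> M" "derx ([:\<beta>, 1:] ^ k) \<in> M"
      "M = der.span {derx [:\<beta>, 1:], derx ([:\<beta>, 1:] ^ k)}"
  | (space) "derx 1 \<in> M" "der.dim M = 3"
      "M = der.span {derx 1, derx [:0, 1:], derx ([:0, 1:] ^ 2)}"
proof -
  define V where "V = derx -` M"
  interpret lin: Vector_Spaces.linear smult der_scale "derx :: 'a poly \<Rightarrow> _"
    by (rule linear_derx)
  from M(1) have sub: "M \<subseteq> multW1 q" "der.subspace M"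
    and br: "\<And>D E. D \<in> M \<Longrightarrow> E \<in> M \<Longrightarrow> commutator D E \<in> M"
    by (auto simp: lie_subalgebra_def)
  have "M \<subseteq> range derx" using sub(1) by (auto simp: multW1_def)
  then have MV: "M = derx ` V" by (auto simp: V_def)
  have subV: "pol.subspace V" unfolding V_def using sub(2) by (rule lin.subspace_vimage)
  have V0: "V \<noteq> {0}" using M(3) MV by auto
  have closed: "\<forall>f\<in>V. \<forall>g\<in>V. wronskian f g \<in> V"
    using br[of "derx _" "derx _"] by (simp add: V_def commutator_derx wronskian_def)
  obtain B where B: "finite B" "der.span B = M" using M(2) by (auto simp: fin_dim_def)
  then have "B \<subseteq> derx ` V" using MV der.span_superset by blast
  then obtain C where C: "finite C" "B = derx ` C" using B(1) finite_subset_image by metis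
  then have "V = pol.span C"
    using B(2) MV inj_image_eq_iff[OF inj_derx] by (metis der_span_derx)
  then obtain n where bounded: "\<forall>f\<in>V. degree f \<le> n"
    using degree_bounded_finite_span[OF C(1)] by metis
  from subV V0 closed bounded show thesis
  proof (cases rule: wronskian_closed_classification)
    case (line f)
    then have "pol.independent {f}" by (simp add: pol.independent_insert)
    then have "der.dim M = 1" unfolding MV line(2) by (simp add: der_dim_span_derx)
    then show ?thesis by (rule that(1))
  next
    case (plane \<beta> k)
    have "M = der.span {derx [:\<beta>, 1:], derx ([:\<beta>, 1:] ^ k)}"
      unfolding MV plane(2) by (simp add: der_span_derx[symmetric])
    moreover have "[:\<beta>, 1:] \<in> V" "[:\<beta>, 1:] ^ k \<in> V" using plane(2) by (auto intro: pol.span_base)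
    ultimately show ?thesis using plane(1) that(2) by (auto simp: V_def)
  next
    case space
    have "M = der.span {derx 1, derx [:0, 1:], derx ([:0, 1:] ^ 2)}"
      unfolding MV space by (simp add: der_span_derx[symmetric])
    moreover have "card {1, [:0, 1:], [:0, 1:] ^ 2 :: 'a poly} = 3"
      by (simp add: power2_eq_square one_pCons)
    then have "der.dim M = 3"
      unfolding MV space by (simp only: der_dim_span_derx[OF independent_powers_upto_2])
    moreover have "1 \<in> V" using space by (auto intro: pol.span_base)
    ultimately show ?thesis using that(3) by (auto simp: V_def)
  qed
qed

theorem proposition3:
  fixes q :: "'a::{alg_closed_field, field_char_0} poly"
  shows
    "(degree q \<ge> 2 \<longrightarrow>
       (\<forall>M. lie_subalgebra M (multW1 q) \<and> fin_dim M \<and> M \<noteq> {0} \<longrightarrow> der.dim M = 1)) \<and>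
     (degree q = 1 \<longrightarrow>
       (\<forall>M. lie_subalgebra M (multW1 q) \<and> fin_dim M \<and> M \<noteq> {0} \<longrightarrow>
          der.dim M = 1 \<or>
          (\<exists>k::nat. k \<ge> 2 \<and> M = der.span {derx q, derx (q ^ k)}))) \<and>
     (degree q = 0 \<and> q \<noteq> 0 \<longrightarrow>
       (\<forall>M. lie_subalgebra M (multW1 q) \<and> fin_dim M \<and> M \<noteq> {0} \<longrightarrow>
          der.dim M = 1 \<or>
          (\<exists>\<beta>. \<exists>k::nat. (k = 0 \<or> k \<ge> 2) \<and>
             M = der.span {derx [:\<beta>, 1:], derx ([:\<beta>, 1:] ^ k)}) \<or>
          (\<exists>\<beta>. der.dim M = 3 \<and>
             M = der.span {derx 1, derx [:\<beta>, 1:], derx ([:\<beta>, 1:] ^ 2)})))"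
proof -
  have no_low: "derx f \<notin> M" if "lie_subalgebra M (multW1 q)" "f \<noteq> 0" "degree f < degree q" for M f
    using lie_subalgebra_elements_dvd[OF that(1)] dvd_imp_degree_le[of q f] that(2,3) by fastforce
  show ?thesis
  proof (intro conjI impI allI; elim conjE)
    fix M assume q: "degree q \<ge> 2" and M: "lie_subalgebra M (multW1 q)" "fin_dim M" "M \<noteq> {0}"
    have "derx [:\<beta>, 1:] \<notin> M" "derx 1 \<notin> M" for \<beta>
      by (intro no_low[OF M(1)]; use q in simp)+
    then show "der.dim M = 1" by (cases rule: lie_subalgebra_classification[OF M]) auto
  next
    fix M assume q: "degree q = 1" and M: "lie_subalgebra M (multW1 q)" "fin_dim M" "M \<noteq> {0}"
    have no_const: "derx 1 \<notin> M"
      by (intro no_low[OF M(1)]; use q in simp)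
    have span_powers: "\<exists>k\<ge>2. M = der.span {derx q, derx (q ^ k)}"
      if l: "derx [:\<beta>, 1:] \<in> M" and k: "k \<ge> 2"
        and span: "M = der.span {derx [:\<beta>, 1:], derx ([:\<beta>, 1:] ^ k)}" for \<beta> k
    proof -
      let ?l = "[:\<beta>, 1:]"
      have "q dvd ?l" using lie_subalgebra_elements_dvd[OF M(1) l] .
      then obtain r where r: "?l = q * r" by (elim dvdE)
      have "q * r \<noteq> 0" and deg: "degree (q * r) = 1" by (simp_all flip: r)
      then have "q \<noteq> 0" "r \<noteq> 0" by auto
      then have "degree r = 0" using q deg degree_mult_eq[of q r] by simp
      then obtain c where "r = [:c:]" by (metis degree_eq_zeroE)
      with r \<open>r \<noteq> 0\<close> have c: "?l = smult c q" "c \<noteq> 0" by auto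
      (* Rescaling the generators individually does not change their span. *)
      have "derx ?l = der_scale c (derx q)"
        "derx (?l ^ k) = der_scale (c ^ k) (derx (q ^ k))"
        unfolding c(1) by (simp_all add: derx_def der_scale_def smult_power fun_eq_iff)
      moreover have "derx q = der_scale (inverse c) (derx ?l)"
        "derx (q ^ k) = der_scale (inverse (c ^ k)) (derx (?l ^ k))"
        using c(2) unfolding calculation by simp_all
      ultimately have "M = der.span {derx q, derx (q ^ k)}"
        unfolding span der.span_eq
        by (metis der.span_base der.span_scale insertCI insert_subset empty_subsetI)
      then show ?thesis using k by blast
    qed
    from M show "der.dim M = 1 \<or> (\<exists>k\<ge>2. M = der.span {derx q, derx (q ^ k)})"
    proof (cases rule: lie_subalgebra_classification)
      case (plane \<beta> k)
      (* For k = 0 the second generator would be the constant 1, which q does not divide. *)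
      then have "k \<ge> 2" using no_const by (cases "k = 0") auto
      with plane show ?thesis using span_powers by blast
    qed (use no_const in auto)
  next
    fix M assume M: "lie_subalgebra M (multW1 q)" "fin_dim M" "M \<noteq> {0}"
    show "der.dim M = 1 \<or>
          (\<exists>\<beta>. \<exists>k::nat. (k = 0 \<or> k \<ge> 2) \<and>
             M = der.span {derx [:\<beta>, 1:], derx ([:\<beta>, 1:] ^ k)}) \<or>
          (\<exists>\<beta>. der.dim M = 3 \<and>
             M = der.span {derx 1, derx [:\<beta>, 1:], derx ([:\<beta>, 1:] ^ 2)})"
      by (cases rule: lie_subalgebra_classification[OF M]) blast+
  qed
qed

end
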